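(* Let $\mathbb{G}$ be a stratified group with $N\ge 3$ the dimension of its first stratum, and let $\Omega\subset\mathbb{G}$ be an open set. Write $x=(x',x'')\in\mathbb{G}$ with $x'=(x'_1,\ldots,x'_N)$ being in the first stratum of $\mathbb{G}$, and let $a_k\in\mathbb{G}$, $k=1,\ldots,m$ (the singularities). Then $$\int_\Omega|\nabla_{\mathbb{G}}u|^2\,dx\ \ge\ \left(\frac{N-2}{2}\right)^2\int_\Omega\frac{\sum_{j=1}^{N}\left|\sum_{k=1}^{m}\frac{(xa_k^{-1})'_j}{|(xa_k^{-1})'|^N}\right|^2}{\left(\sum_{k=1}^{m}\frac{1}{|(xa_k^{-1})'|^{N-2}}\right)^2}|u|^2\,dx$$ for all $u\in C_0^\infty(\Omega)$.
   Context: A stratified group (homogeneous Carnot group) $\mathbb{G}=(\mathbb{R}^d,\circ,\delta_\lambda)$ of step $r$ is a Lie group structure on $\mathbb{R}^d$, with points written $x=(x',x^{(2)},\ldots,x^{(r)})=(x',x'')$, $x'=(x'_1,\ldots,x'_N)\in\mathbb{R}^N$, $x^{(l)}=(x^{(l)}_1,\ldots,x^{(l)}_{N_l})\in\mathbb{R}^{N_l}$, such that the dilations $\delta_\lambda(x)=(\lambda x',\lambda^2x^{(2)},\ldots,\lambda^rx^{(r)})$, $\lambda>0$, are group automorphisms, and such that the left-invariant vector fields $X_1,\ldots,X_N$ with $X_k(0)=\partial/\partial x'_k|_0$ (the Jacobian generators of the first stratum) generate, together with their iterated commutators, the whole Lie algebra. Explicitly, $X_k=\frac{\partial}{\partial x'_k}+\sum_{l=2}^{r}\sum_{m=1}^{N_l}a^{(l)}_{k,m}(x',\ldots,x^{(l-1)})\frac{\partial}{\partial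 x^{(l)}_m}$. The horizontal gradient is $\nabla_{\mathbb{G}}=(X_1,\ldots,X_N)$. For $a_k=(a'_k,a''_k)$ with $a'_k=(a'_{k1},\ldots,a'_{kN})$ in the first stratum, one has $(xa_k^{-1})'=x'-a'_k$ and $(xa_k^{-1})'_j=x'_j-a'_{kj}$. $|\cdot|$ on $\mathbb{R}^N$ is the Euclidean norm. $dx$ is Lebesgue measure on $\mathbb{R}^d$, which is the Haar measure of $\mathbb{G}$. *)

theory Defs
  imports "HOL-Analysis.Analysis" "HOL-Algebra.Group"
begin

text \<open>
  Points of the group are vectors of type \<open>real ^ 'd\<close>, so that \<open>d = CARD('d)\<close>. The splitting
  \<open>x = (x', x\<^sup>(\<^sup>2\<^sup>), \<dots>, x\<^sup>(\<^sup>r\<^sup>))\<close> of the coordinates is a weight function \<open>\<sigma> :: 'd \<Rightarrow> nat\<close>: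
  the \<open>l\<close>-th stratum consists of the coordinates \<open>i\<close> with \<open>\<sigma> i = l\<close>.
\<close>

definition stratum :: "('d \<Rightarrow> nat) \<Rightarrow> nat \<Rightarrow> 'd set"
  where "stratum \<sigma> l = {i. \<sigma> i = l}"

text \<open>
  \<open>x'\<close>, where \<open>\<real>\<^sup>N\<close> is embedded isometrically in \<open>\<real>\<^sup>d\<close> by padding with zeros;
  hence \<^term>\<open>norm (first_layer \<sigma> x)\<close> is the Euclidean norm of \<open>x' \<in> \<real>\<^sup>N\<close>.
\<close>

definition first_layer :: "('d \<Rightarrow> nat) \<Rightarrow> 'a::zero ^ 'd \<Rightarrow> 'a ^ 'd"
  where "first_layer \<sigma> x = (\<chi> i. if i \<in> stratum \<sigma> 1 then x $ i else 0)"

definition dilation :: "('d \<Rightarrow> nat) \<Rightarrow> real \<Rightarrow> real ^ 'd \<Rightarrow> real ^ 'd"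
  where "dilation \<sigma> c x = (\<chi> i. c ^ \<sigma> i * x $ i)"

primrec times_cont_diff :: "nat \<Rightarrow> ('a::real_normed_vector \<Rightarrow> 'b::real_normed_vector) \<Rightarrow> bool"
  where
    "times_cont_diff 0 f \<longleftrightarrow> continuous_on UNIV f"
  | "times_cont_diff (Suc n) f \<longleftrightarrow>
       (\<forall>x. f differentiable (at x)) \<and>
       (\<forall>v. times_cont_diff n (\<lambda>x. frechet_derivative f (at x) v))"

definition smooth :: "('a::real_normed_vector \<Rightarrow> 'b::real_normed_vector) \<Rightarrow> bool"
  where "smooth f \<longleftrightarrow> (\<forall>n. times_cont_diff n f)"

text \<open>
  Functions in \<open>C\<^sub>0\<^sup>\<infinity>(\<Omega>)\<close> are identified with their extensions by zero to the whole space.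
\<close>

definition test_functions :: "'a::real_normed_vector set \<Rightarrow> ('a \<Rightarrow> complex) set"
  where "test_functions \<Omega> =
    {u. smooth u \<and> compact (closure {x. u x \<noteq> 0}) \<and> closure {x. u x \<noteq> 0} \<subseteq> \<Omega>}"

text \<open>
  A vector field \<open>\<Sum>\<^sub>i X\<^sub>i \<partial>/\<partial>x\<^sub>i\<close> is represented by its coefficient map \<open>X\<close>.
\<close>

definition apply_field ::
    "('a::real_normed_vector \<Rightarrow> 'a) \<Rightarrow> ('a \<Rightarrow> 'b::real_normed_vector) \<Rightarrow> 'a \<Rightarrow> 'b"
  where "apply_field X u x = frechet_derivative u (at x) (X x)"

definition lie_bracket ::
    "('a::real_normed_vector \<Rightarrow> 'a) \<Rightarrow> ('a \<Rightarrow> 'a) \<Rightarrow> ('a \<Rightarrow> 'a)"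
  where "lie_bracket X Y = (\<lambda>x. apply_field X Y x - apply_field Y X x)"

inductive_set lie_generated ::
    "('a::real_normed_vector \<Rightarrow> 'a) set \<Rightarrow> ('a \<Rightarrow> 'a) set"
  for \<X> :: "('a \<Rightarrow> 'a) set"
  where
    generator: "X \<in> \<X> \<Longrightarrow> X \<in> lie_generated \<X>"
  | zero: "(\<lambda>x. 0) \<in> lie_generated \<X>"
  | add: "X \<in> lie_generated \<X> \<Longrightarrow> Y \<in> lie_generated \<X> \<Longrightarrow> (\<lambda>x. X x + Y x) \<in> lie_generated \<X>"
  | scale: "X \<in> lie_generated \<X> \<Longrightarrow> (\<lambda>x. c *\<^sub>R X x) \<in> lie_generated \<X>"
  | bracket: "X \<in> lie_generated \<X> \<Longrightarrow> Y \<in> lie_generated \<X> \<Longrightarrow> lie_bracket X Y \<in> lie_generated \<X>"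

definition left_invariant :: "'a::real_normed_vector monoid \<Rightarrow> ('a \<Rightarrow> 'a) \<Rightarrow> bool"
  where "left_invariant G X \<longleftrightarrow>
    (\<forall>x y. X (x \<otimes>\<^bsub>G\<^esub> y) = frechet_derivative (\<lambda>z. x \<otimes>\<^bsub>G\<^esub> z) (at y) (X y))"

text \<open>
  The identity of a stratified group is the origin, see \<open>one_eq_zero\<close> below, and the field
  described here exists and is unique, see \<open>ex1_jacobian_generator\<close>.
\<close>

definition jacobian_generator :: "(real ^ 'd) monoid \<Rightarrow> 'd \<Rightarrow> real ^ 'd \<Rightarrow> real ^ 'd"
  where "jacobian_generator G k = (THE X. left_invariant G X \<and> X 0 = axis k 1)"

definition horizontal_gradient ::
    "(real ^ 'd) monoid \<Rightarrow> ('d \<Rightarrow> nat) \<Rightarrow> (real ^ 'd \<Rightarrow> complex) \<Rightarrow> real ^ 'd \<Rightarrow> complex ^ 'd"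
  where "horizontal_gradient G \<sigma> u x =
    first_layer \<sigma> (\<chi> k. apply_field (jacobian_generator G k) u x)"

locale stratified_group = group G
  for G :: "(real ^ 'd) monoid" (structure) +
  fixes \<sigma> :: "'d \<Rightarrow> nat" and r :: nat
  assumes carrier_eq: "carrier G = UNIV"
    and smooth_mult: "smooth (\<lambda>(x, y). x \<otimes> y)"
    and smooth_inv: "smooth (\<lambda>x. inv x)"
    and strata: "range \<sigma> = {1..r}"
    and dilation_iso: "c > 0 \<Longrightarrow> dilation \<sigma> c \<in> iso G G"
    and generates: "lie_generated (jacobian_generator G ` stratum \<sigma> 1) = {X. left_invariant G X}"
begin

lemma one_eq_zero: "\<one> = 0"
proof -
  have "dilation \<sigma> 2 \<in> hom G G"
    using dilation_iso[of 2] by (simp add: iso_def)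
  then have h: "dilation \<sigma> 2 \<one> = \<one>"
    using hom_one[OF _ is_group is_group] by blast
  show ?thesis
  proof (rule vec_eq_iff[THEN iffD2], rule allI)
    fix i
    have "\<sigma> i > 0" using strata by force
    then have "(1::real) < 2 ^ \<sigma> i" by (intro one_less_power) simp_all
    then have "(2::real) ^ \<sigma> i \<noteq> 1" by simp
    moreover have "2 ^ \<sigma> i * \<one> $ i = \<one> $ i"
      using arg_cong[OF h, of "\<lambda>x. x $ i"] by (simp add: dilation_def)
    ultimately show "\<one> $ i = 0 $ i" by simp
  qed
qed

lemma mult_zero [simp]: "x \<otimes> 0 = x" "0 \<otimes> x = x"
  by (metis UNIV_I carrier_eq one_eq_zero r_one, metis UNIV_I carrier_eq l_one one_eq_zero)

lemma left_mult_differentiable: "(\<lambda>z. x \<otimes> z) differentiable (at y)"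
proof -
  have "(\<lambda>(x, y). x \<otimes> y) differentiable (at (x, y))"
    using smooth_mult[unfolded smooth_def, rule_format, of 1] by simp
  moreover have "(\<lambda>z. (x, z)) differentiable (at y)"
    unfolding differentiable_def by (intro exI) (rule derivative_intros)+
  ultimately show ?thesis
    using differentiable_chain_at[of "\<lambda>z. (x, z)" y "\<lambda>(x, y). x \<otimes> y"] by (simp add: o_def)
qed

lemma left_invariant_columns:
  "left_invariant G (\<lambda>x. frechet_derivative (\<lambda>z. x \<otimes> z) (at 0) v)"
  unfolding left_invariant_def
proof (intro allI)
  fix x y
  note D = left_mult_differentiable[THEN frechet_derivative_works[THEN iffD1]]
  have "((\<lambda>z. x \<otimes> (y \<otimes> z)) has_derivative
      frechet_derivative (\<lambda>z. x \<otimes> z) (at y) \<circ> frechet_derivative (\<lambda>z. y \<otimes> z) (at 0)) (at 0)"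
    using diff_chain_at[OF D[of y 0], of "\<lambda>z. x \<otimes> z"] D[of x y]
    by (simp add: o_def)
  then have "((\<lambda>z. (x \<otimes> y) \<otimes> z) has_derivative
      frechet_derivative (\<lambda>z. x \<otimes> z) (at y) \<circ> frechet_derivative (\<lambda>z. y \<otimes> z) (at 0)) (at 0)"
    by (simp add: m_assoc carrier_eq)
  from frechet_derivative_at[OF this]
  show "frechet_derivative (\<lambda>z. x \<otimes> y \<otimes> z) (at 0) v =
      frechet_derivative (\<lambda>z. x \<otimes> z) (at y) (frechet_derivative (\<lambda>z. y \<otimes> z) (at 0) v)"
    by (metis comp_apply)
qed

lemma left_invariant_unique:
  assumes "left_invariant G X"
  shows "X = (\<lambda>x. frechet_derivative (\<lambda>z. x \<otimes> z) (at 0) (X 0))"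
proof
  fix x
  have "X (x \<otimes> 0) = frechet_derivative (\<lambda>z. x \<otimes> z) (at 0) (X 0)"
    using assms unfolding left_invariant_def by blast
  then show "X x = frechet_derivative (\<lambda>z. x \<otimes> z) (at 0) (X 0)"
    by simp
qed

lemma columns_at_zero: "frechet_derivative (\<lambda>z. 0 \<otimes> z) (at 0) v = v"
  by simp

lemma ex1_jacobian_generator: "\<exists>!X. left_invariant G X \<and> X 0 = axis k 1"
proof (rule ex1I)
  show "left_invariant G (\<lambda>x. frechet_derivative (\<lambda>z. x \<otimes> z) (at 0) (axis k 1)) \<and>
      frechet_derivative (\<lambda>z. 0 \<otimes> z) (at 0) (axis k 1) = axis k 1"
    by (simp add: left_invariant_columns columns_at_zero)
next
  fix X assume X: "left_invariant G X \<and> X 0 = axis k 1"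
  then show "X = (\<lambda>x. frechet_derivative (\<lambda>z. x \<otimes> z) (at 0) (axis k 1))"
    using left_invariant_unique[of X] by simp
qed

lemma jacobian_generator_eq:
  "jacobian_generator G k = (\<lambda>x. frechet_derivative (\<lambda>z. x \<otimes> z) (at 0) (axis k 1))"
  unfolding jacobian_generator_def
  by (rule the1_equality[OF ex1_jacobian_generator])
    (simp add: left_invariant_columns columns_at_zero)

end

end

theory Submission
  imports Defs
begin

text \<open>
  The Hardy weight is the squared length of a logarithmic gradient. Let
  \<open>w(x) = \<Sum>\<^sub>k \<bar>x' - a\<^sub>k'\<bar>\<^bsup>2 - N\<^esup>\<close>. Since \<open>(x \<otimes> inv a\<^sub>k)' = x' - a\<^sub>k'\<close>, the claim reads
  \<open>\<integral> \<bar>\<nabla>u\<bar>\<^sup>2 \<ge> 1/4 \<integral> (\<bar>\<nabla>w\<bar> / w)\<^sup>2 \<bar>u\<bar>\<^sup>2\<close>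
  with \<open>\<nabla>\<close> the horizontal gradient. It follows from
  \<open>\<bar>\<nabla>u - (\<nabla>w / 2 w) u\<bar>\<^sup>2 \<ge> 0\<close>: the cross term is integrated by parts, and then only
  \<open>\<Delta>w \<le> 0\<close> is needed, where \<open>\<Delta> = \<Sum>\<^sub>j X\<^sub>j X\<^sub>j\<close> is the sub-Laplacian. Three points
  make this precise.

  \<^item> The geometry of the group enters only through dilations. They show that multiplication is
    addition on the first stratum (\<open>mult_stratum_1\<close>), so that \<open>X\<^sub>j\<close> acts on functions of \<open>x'\<close> as
    \<open>\<partial>\<^sub>j\<close> and \<open>\<Delta>w\<close> is the Euclidean Laplacian of \<open>w\<close> in \<open>\<real>\<^sup>N\<close>. They also show that the coefficient of
    \<open>X\<^sub>j\<close> in a direction \<open>i\<close> does not depend on \<open>x\<^sub>i\<close> (\<open>generator_coefficient_constant\<close>), so that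
    \<open>X\<^sub>j\<close> is divergence free and integration by parts is valid (\<open>integral_generator_eq_0\<close>).

  \<^item> To avoid the poles, \<open>\<bar>x' - a\<^sub>k'\<bar>\<close> is replaced by \<open>sqrt (\<epsilon> + \<bar>x' - a\<^sub>k'\<bar>\<^sup>2)\<close>. The
    resulting \<open>w\<close> is smooth, positive and still superharmonic (\<open>divergence_log_force_ge\<close>), and the
    inequality for it is \<open>regularised_hardy_inequality\<close>.

  \<^item> As \<open>\<epsilon>\<close> tends to zero the weights converge off the poles, which form a null set, and Fatou's
    lemma carries the inequality over to the limit.
\<close>

section \<open>Integrals of directional derivatives\<close>

lemma integrable_continuous_bounded_support:
  fixes f :: "'a::euclidean_space \<Rightarrow> real"
  assumes "continuous_on UNIV f" and supp: "\<And>x. norm x > R \<Longrightarrow> f x = 0"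
  shows "integrable lborel f"
proof -
  have "integrable lborel (\<lambda>x. indicator (cball 0 R) x *\<^sub>R f x)"
    using assms(1) by (intro borel_integrable_compact) (auto intro: continuous_on_subset)
  moreover have "indicator (cball 0 R) x *\<^sub>R f x = f x" for x
    using supp[of x] by (cases "x \<in> cball 0 R") auto
  ultimately show ?thesis by (simp only:)
qed

text \<open>
  The integrals of the difference quotients of \<open>h\<close> along \<open>e\<close> vanish because Lebesgue measure is
  translation invariant. The quotients are dominated by a constant on a fixed ball, so the limit
  may be taken under the integral. Only the derivative along \<open>e\<close> is required to exist, so that the
  lemma applies to \<open>h = a \<phi>\<close> where \<open>a\<close> is merely continuous but constant along \<open>e\<close>.
\<close>
lemma integral_directional_derivative_eq_0:
  fixes h h' :: "'a::euclidean_space \<Rightarrow> real"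
  assumes deriv: "\<And>x. ((\<lambda>t. h (x + t *\<^sub>R e)) has_real_derivative h' x) (at 0)"
    and cont: "continuous_on UNIV h" and cont': "continuous_on UNIV h'"
    and supp: "\<And>x. h x \<noteq> 0 \<Longrightarrow> norm x \<le> R"
  shows "integrable lborel h'" and "(\<integral>x. h' x \<partial>lborel) = 0"
proof -
  \<comment> \<open>All translates of \<open>h\<close> by \<open>t e\<close> with \<open>0 \<le> t \<le> 1\<close> are supported in this ball.\<close>
  define K where "K = cball (0::'a) (\<bar>R\<bar> + norm e)"
  have K: "compact K" unfolding K_def by simp
  have h0: "h x = 0" if "norm x > R" for x
    using supp[of x] that by force
  have h'0: "h' x = 0" if "norm x > R" for x
  proof -
    have "((\<lambda>t. norm (x + t *\<^sub>R e)) \<longlongrightarrow> norm (x + 0 *\<^sub>R e)) (at 0)"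
      by (intro tendsto_intros)
    then have "eventually (\<lambda>t. norm (x + t *\<^sub>R e) > R) (at 0)"
      using that by (intro order_tendstoD(1)) auto
    then have "eventually (\<lambda>t. norm (x + t *\<^sub>R e) > R) (nhds 0)"
      using that by (simp add: eventually_at_filter eventually_mono)
         (auto elim: eventually_mono)
    then have ev: "eventually (\<lambda>t. h (x + t *\<^sub>R e) = 0) (nhds 0)"
      by (rule eventually_mono) (rule h0)
    have "((\<lambda>t. 0::real) has_real_derivative h' x) (at 0)"
      using deriv[of x] DERIV_cong_ev[OF refl ev refl, of "h' x"] by simp
    then show ?thesis
      using DERIV_unique DERIV_const by blast
  qed
  show int': "integrable lborel h'"
    using cont' h'0 by (rule integrable_continuous_bounded_support)
  have int: "integrable lborel h"
    using cont h0 by (rule integrable_continuous_bounded_support)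
  obtain C where C: "\<And>x. \<bar>h' x\<bar> \<le> C"
  proof -
    have "compact (h' ` K)"
      using K cont' by (intro compact_continuous_image) (auto intro: continuous_on_subset)
    then obtain C where C: "\<And>y. y \<in> h' ` K \<Longrightarrow> norm y \<le> C"
      using compact_imp_bounded bounded_iff by metis
    have "\<bar>h' x\<bar> \<le> \<bar>C\<bar>" for x
    proof (cases "x \<in> K")
      case True
      then show ?thesis using C[of "h' x"] by force
    next
      case False
      then have "norm x > R"
        using norm_ge_zero[of e] unfolding K_def mem_cball dist_0_norm by linarith
      then show ?thesis using h'0 by simp
    qed
    then show ?thesis using that by blast
  qed
  have line: "((\<lambda>t. h (x + t *\<^sub>R e)) has_real_derivative h' (x + t *\<^sub>R e)) (at t)" for x t
  proof -
    have "((\<lambda>s. h ((x + t *\<^sub>R e) + s *\<^sub>R e)) has_real_derivative h' (x + t *\<^sub>R e)) (at 0)"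
      by (rule deriv)
    then have "((\<lambda>s. h (x + (t + s) *\<^sub>R e)) has_real_derivative h' (x + t *\<^sub>R e)) (at 0)"
      by (simp add: algebra_simps)
    then show ?thesis
      using DERIV_shift[of "\<lambda>s. h (x + s *\<^sub>R e)" "h' (x + t *\<^sub>R e)" 0 t]
      by (simp add: add.commute)
  qed
  define s where "s n = inverse (real (Suc n))" for n
  define D where "D n x = (h (x + s n *\<^sub>R e) - h x) / s n" for n x
  have s: "0 < s n" "s n \<le> 1" for n
    unfolding s_def by (auto simp: field_simps)
  have s0: "s \<longlonglongrightarrow> 0"
    unfolding s_def by (rule LIMSEQ_inverse_real_of_nat)
  have shift: "(\<integral>x. h (x + c) \<partial>lborel) = (\<integral>x. h x \<partial>lborel)" "integrable lborel (\<lambda>x. h (x + c))" for c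
  proof -
    have meas: "h \<in> borel_measurable borel"
      using cont by (rule borel_measurable_continuous_onI)
    have "(\<integral>x. h x \<partial>distr lborel borel ((+) c)) = (\<integral>x. h (c + x) \<partial>lborel)"
      by (rule integral_distr) (use meas in auto)
    then show "(\<integral>x. h (x + c) \<partial>lborel) = (\<integral>x. h x \<partial>lborel)"
      by (simp add: lborel_distr_plus add.commute)
    have "integrable (distr lborel borel ((+) c)) h \<longleftrightarrow> integrable lborel (\<lambda>x. h (c + x))"
      by (rule integrable_distr_eq) (use meas in auto)
    then show "integrable lborel (\<lambda>x. h (x + c))"
      using int by (simp add: lborel_distr_plus add.commute)
  qed
  have D_int: "(\<integral>x. D n x \<partial>lborel) = 0" for n
    unfolding D_def using shift[of "s n *\<^sub>R e"] int by simp
  have D_lim: "(\<lambda>n. D n x) \<longlonglongrightarrow> h' x" for x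
  proof -
    have "((\<lambda>t. (h (x + t *\<^sub>R e) - h x) / t) \<longlongrightarrow> h' x) (at 0)"
      using deriv[of x] by (simp add: DERIV_def)
    moreover have "filterlim s (at 0) sequentially"
      using s0 s(1) by (auto simp: filterlim_at less_imp_neq[symmetric])
    ultimately show ?thesis
      unfolding D_def by (rule filterlim_compose)
  qed
  have D_bound: "norm (D n x) \<le> C * indicator K x" for n x
  proof (cases "x \<in> K")
    case True
    obtain z where "h (x + s n *\<^sub>R e) - h (x + 0 *\<^sub>R e) = (s n - 0) * h' (x + z *\<^sub>R e)"
      using MVT2[of 0 "s n" "\<lambda>t. h (x + t *\<^sub>R e)" "\<lambda>t. h' (x + t *\<^sub>R e)"] s(1)[of n] line by blast
    then have "D n x = h' (x + z *\<^sub>R e)"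
      using s(1)[of n] by (simp add: D_def)
    then show ?thesis using C True by simp
  next
    case False
    then have far: "norm x > \<bar>R\<bar> + norm e"
      unfolding K_def by simp
    have "norm (s n *\<^sub>R e) \<le> norm e"
      using s[of n] by (simp add: mult_left_le_one_le)
    then have "norm (x + s n *\<^sub>R e) > R"
      using far norm_diff_ineq[of x "s n *\<^sub>R e"] by linarith
    moreover have "norm x > R"
      using far norm_ge_zero[of e] by linarith
    ultimately show ?thesis using False h0 by (simp add: D_def)
  qed
  have "(\<lambda>n. \<integral>x. D n x \<partial>lborel) \<longlonglongrightarrow> (\<integral>x. h' x \<partial>lborel)"
  proof (rule integral_dominated_convergence)
    show "h' \<in> borel_measurable lborel"
      using cont' by (simp add: borel_measurable_continuous_onI)
    show "D n \<in> borel_measurable lborel" for n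
      unfolding D_def using shift(2)[of "s n *\<^sub>R e"] int by (intro borel_measurable_integrable) simp
    show "integrable lborel (\<lambda>x. C * indicator K x)"
      using K emeasure_compact_finite[OF K]
      by (intro integrable_mult_right integrable_real_indicator) (simp_all add: compact_imp_closed)
  qed (use D_lim D_bound in auto)
  then show "(\<integral>x. h' x \<partial>lborel) = 0"
    by (simp add: D_int LIMSEQ_const_iff)
qed

section \<open>Derivatives of smooth functions\<close>

lemma smooth_has_derivative: "smooth f \<Longrightarrow> (f has_derivative frechet_derivative f (at x)) (at x)"
  unfolding smooth_def using times_cont_diff.simps(2)[of 0 f] frechet_derivative_works by blast

lemma smooth_continuous_on: "smooth f \<Longrightarrow> continuous_on UNIV f"
  unfolding smooth_def using times_cont_diff.simps(1) by blast

lemma smooth_frechet_derivative: "smooth f \<Longrightarrow> smooth (\<lambda>x. frechet_derivative f (at x) v)"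
  unfolding smooth_def using times_cont_diff.simps(2) by blast

lemma linear_eq_sum_axis:
  fixes f :: "real ^ 'd \<Rightarrow> 'b::real_vector"
  assumes "linear f"
  shows "f y = (\<Sum>i\<in>UNIV. (y $ i) *\<^sub>R f (axis i 1))"
proof -
  have "y = (\<Sum>i\<in>UNIV. (y $ i) *\<^sub>R axis i 1)"
    by (simp add: vec_eq_iff axis_def if_distrib cong: if_cong)
  then have "f y = f (\<Sum>i\<in>UNIV. (y $ i) *\<^sub>R axis i 1)"
    by simp
  then show ?thesis
    by (simp only: linear_sum[OF assms] linear_scale[OF assms])
qed

lemma frechet_derivative_outside_support:
  fixes u :: "'a::real_normed_vector \<Rightarrow> 'b::real_normed_vector"
  assumes "x \<notin> closure {x. u x \<noteq> 0}"
  shows "frechet_derivative u (at x) v = 0"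
proof -
  have "(u has_derivative (\<lambda>v. 0)) (at x)"
  proof (rule has_derivative_transform_within_open)
    show "((\<lambda>x. 0) has_derivative (\<lambda>v. 0)) (at x)" by simp
    show "open (- closure {x. u x \<noteq> 0})" by (intro open_Compl closed_closure)
    show "x \<in> - closure {x. u x \<noteq> 0}" using assms by simp
    show "0 = u y" if "y \<in> - closure {x. u x \<noteq> 0}" for y
      using that closure_subset[of "{x. u x \<noteq> 0}"] by auto
  qed
  from frechet_derivative_at[OF this] show ?thesis by metis
qed

section \<open>First-stratum generators of a stratified group\<close>

lemma bounded_linear_dilation: "bounded_linear (dilation \<sigma> c)"
  by (intro linear_conv_bounded_linear[THEN iffD1] linearI)
     (simp_all add: dilation_def vec_eq_iff algebra_simps)

lemma dilation_axis: "dilation \<sigma> c (axis k 1) = c ^ \<sigma> k *\<^sub>R axis k 1"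
  by (simp add: dilation_def vec_eq_iff axis_def)

lemma tendsto_dilation_0:
  assumes "\<And>i. \<sigma> i \<noteq> 0"
  shows "((\<lambda>c. dilation \<sigma> c x) \<longlongrightarrow> 0) (at_right 0)"
proof -
  have "((\<lambda>c. \<chi> i. c ^ \<sigma> i * x $ i) \<longlongrightarrow> (\<chi> i. 0 ^ \<sigma> i * x $ i)) (at_right 0)"
    by (intro tendsto_vec_lambda tendsto_intros)
  moreover have "(\<chi> i. 0 ^ \<sigma> i * x $ i) = 0"
    using assms by (simp add: vec_eq_iff zero_power)
  ultimately show ?thesis by (simp add: dilation_def[abs_def])
qed

text \<open>
  Coordinates of weight at least two are killed at first order, which is how the first stratum is
  singled out.
\<close>
lemma dilation_derivative_0:
  assumes "\<And>i. \<sigma> i \<noteq> 0"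
  shows "((\<lambda>c. dilation \<sigma> c x) has_derivative (\<lambda>c. c *\<^sub>R first_layer \<sigma> x)) (at 0)"
proof -
  have "((\<lambda>c. dilation \<sigma> c x $ i) has_derivative (\<lambda>c. c * first_layer \<sigma> x $ i)) (at 0)" for i
  proof -
    have "((\<lambda>c. c ^ \<sigma> i * x $ i) has_real_derivative
        real (\<sigma> i) * 0 ^ (\<sigma> i - 1) * x $ i) (at 0)"
      by (auto intro!: derivative_eq_intros)
    moreover have "real (\<sigma> i) * 0 ^ (\<sigma> i - 1) * x $ i = first_layer \<sigma> x $ i"
      using assms[of i] by (auto simp: first_layer_def stratum_def zero_power)
    ultimately have "((\<lambda>c. dilation \<sigma> c x $ i) has_real_derivative first_layer \<sigma> x $ i) (at 0)"
      by (simp only: dilation_def vec_lambda_beta)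
    then show ?thesis
      by (simp add: has_field_derivative_def mult_commute_abs)
  qed
  then show ?thesis
    by (subst has_derivative_componentwise_within) (auto simp: Basis_vec_def inner_axis)
qed

context stratified_group
begin

lemma weight_nonzero: "\<sigma> i \<noteq> 0"
  using strata by (metis atLeastAtMost_iff not_one_le_zero rangeI)

lemma dilation_mult:
  assumes "c > 0"
  shows "dilation \<sigma> c (x \<otimes> y) = dilation \<sigma> c x \<otimes> dilation \<sigma> c y"
  using dilation_iso[OF assms] carrier_eq by (auto simp: iso_def hom_def)

text \<open>
  On the first stratum the group is the additive group. Indeed \<open>F(x, y) = (x \<otimes> y)\<^sub>i\<close> is homogeneous
  of degree one along the curves \<open>c \<mapsto> (\<delta>\<^sub>c x, \<delta>\<^sub>c y)\<close>, so it equals its derivative at the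
  origin in their initial direction \<open>(x', y')\<close>; hence it is linear in \<open>(x', y')\<close>, and the values
  at \<open>(x, 0)\<close> and \<open>(0, y)\<close> are known.
\<close>
lemma mult_stratum_1:
  assumes i: "i \<in> stratum \<sigma> 1"
  shows "(x \<otimes> y) $ i = x $ i + y $ i"
proof -
  define F where "F = (\<lambda>(x, y). x \<otimes> y)"
  define L where "L = frechet_derivative F (at (0, 0))"
  have F: "(F has_derivative L) (at (0, 0))"
    unfolding L_def F_def by (rule smooth_has_derivative[OF smooth_mult])
  then interpret L: linear L
    by (rule has_derivative_linear)
  have eq: "(x \<otimes> y) $ i = L (first_layer \<sigma> x, first_layer \<sigma> y) $ i" for x y
  proof -
    \<comment> \<open>The curve has a two-sided derivative at 0, but homogeneity is available only for
      \<open>c > 0\<close>; the two are compared through the right-hand limit.\<close>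
    have d0: "dilation \<sigma> 0 z = 0" for z
      using weight_nonzero by (simp add: dilation_def vec_eq_iff zero_power)
    have "((\<lambda>c. F (dilation \<sigma> c x, dilation \<sigma> c y)) has_derivative
        (\<lambda>c. L (c *\<^sub>R first_layer \<sigma> x, c *\<^sub>R first_layer \<sigma> y))) (at 0)"
      by (rule has_derivative_compose[of "\<lambda>c. (dilation \<sigma> c x, dilation \<sigma> c y)" _ 0 UNIV F L, simplified])
         (auto intro!: has_derivative_Pair dilation_derivative_0 weight_nonzero simp: d0 F)
    moreover have "L (c *\<^sub>R first_layer \<sigma> x, c *\<^sub>R first_layer \<sigma> y) =
        c *\<^sub>R L (first_layer \<sigma> x, first_layer \<sigma> y)" for c
      using L.scale[of c "(first_layer \<sigma> x, first_layer \<sigma> y)"] by simp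
    ultimately have "((\<lambda>c. F (dilation \<sigma> c x, dilation \<sigma> c y)) has_vector_derivative
        L (first_layer \<sigma> x, first_layer \<sigma> y)) (at 0)"
      by (simp add: has_vector_derivative_def)
    then have "((\<lambda>c. F (dilation \<sigma> c x, dilation \<sigma> c y) $ i) has_vector_derivative
        L (first_layer \<sigma> x, first_layer \<sigma> y) $ i) (at 0)"
      by (rule bounded_linear.has_vector_derivative[OF bounded_linear_vec_nth])
    then have "((\<lambda>c. F (dilation \<sigma> c x, dilation \<sigma> c y) $ i / c) \<longlongrightarrow>
        L (first_layer \<sigma> x, first_layer \<sigma> y) $ i) (at 0)"
      by (simp add: has_real_derivative_iff_has_vector_derivative[symmetric] DERIV_def d0 F_def)
    then have "((\<lambda>c. F (dilation \<sigma> c x, dilation \<sigma> c y) $ i / c) \<longlongrightarrow>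
        L (first_layer \<sigma> x, first_layer \<sigma> y) $ i) (at_right 0)"
      by (rule tendsto_mono[rotated]) (simp add: at_le)
    moreover have "eventually (\<lambda>c. F (dilation \<sigma> c x, dilation \<sigma> c y) $ i / c = (x \<otimes> y) $ i)
        (at_right 0)"
      using eventually_at_right_less[of "0::real"]
    proof eventually_elim
      case (elim c)
      then show ?case
        using i by (simp add: F_def dilation_mult[symmetric]) (simp add: dilation_def stratum_def)
    qed
    ultimately have "((\<lambda>c. (x \<otimes> y) $ i) \<longlongrightarrow> L (first_layer \<sigma> x, first_layer \<sigma> y) $ i) (at_right (0::real))"
      by (rule Lim_transform_eventually)
    then show ?thesis
      using tendsto_unique[OF trivial_limit_at_right_real tendsto_const] by blast
  qed
  have fl0: "first_layer \<sigma> (0 :: real ^ 'd) = 0"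
    by (simp add: first_layer_def vec_eq_iff)
  have "(x \<otimes> y) $ i = L ((first_layer \<sigma> x, 0) + (0, first_layer \<sigma> y)) $ i"
    using eq by simp
  also have "\<dots> = (x \<otimes> 0) $ i + (0 \<otimes> y) $ i"
    unfolding eq fl0 L.add by simp
  finally show ?thesis by simp
qed

lemma inv_stratum_1:
  assumes "i \<in> stratum \<sigma> 1"
  shows "(inv x) $ i = - x $ i"
proof -
  have "x \<otimes> inv x = 0"
    using r_inv[of x] by (simp add: carrier_eq one_eq_zero)
  then show ?thesis
    using mult_stratum_1[OF assms, of x "inv x"] by simp
qed

lemma left_mult_has_derivative:
  "((\<lambda>z. x \<otimes> z) has_derivative frechet_derivative (\<lambda>z. x \<otimes> z) (at y)) (at y)"
  using left_mult_differentiable frechet_derivative_works by blast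

text \<open>
  Functions of \<open>x'\<close> alone are therefore differentiated by the generators as by the Euclidean
  partial derivatives.
\<close>
lemma generator_stratum_1:
  assumes "j \<in> stratum \<sigma> 1"
  shows "jacobian_generator G k x $ j = axis k 1 $ j"
proof -
  have "((\<lambda>z. (x \<otimes> z) $ j) has_derivative
      (\<lambda>v. frechet_derivative (\<lambda>z. x \<otimes> z) (at 0) v $ j)) (at 0)"
    by (rule bounded_linear.has_derivative[OF bounded_linear_vec_nth left_mult_has_derivative])
  moreover have "((\<lambda>z. (x \<otimes> z) $ j) has_derivative (\<lambda>v. v $ j)) (at 0)"
    unfolding mult_stratum_1[OF assms]
    by (auto intro!: derivative_eq_intros bounded_linear.has_derivative[OF bounded_linear_vec_nth])
  ultimately have "(\<lambda>v. frechet_derivative (\<lambda>z. x \<otimes> z) (at 0) v $ j) = (\<lambda>v. v $ j)"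
    by (rule has_derivative_unique)
  then show ?thesis
    by (simp add: jacobian_generator_eq fun_eq_iff)
qed

text \<open>
  Differentiating \<open>\<delta>\<^sub>c (x \<otimes> z) = \<delta>\<^sub>c x \<otimes> \<delta>\<^sub>c z\<close> at \<open>z = 0\<close>: the coefficient of a first-stratum
  generator in direction \<open>i\<close> is homogeneous of degree \<open>\<sigma> i - 1\<close>.
\<close>
lemma generator_dilation:
  assumes "c > 0"
  shows "c ^ \<sigma> k *\<^sub>R jacobian_generator G k (dilation \<sigma> c x) = dilation \<sigma> c (jacobian_generator G k x)"
proof -
  let ?D = "\<lambda>x. frechet_derivative (\<lambda>z. x \<otimes> z) (at 0)"
  have "((\<lambda>z. dilation \<sigma> c (x \<otimes> z)) has_derivative (\<lambda>v. dilation \<sigma> c (?D x v))) (at 0)"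
    by (rule bounded_linear.has_derivative[OF bounded_linear_dilation left_mult_has_derivative])
  moreover have "((\<lambda>z. dilation \<sigma> c x \<otimes> dilation \<sigma> c z) has_derivative
      (\<lambda>v. ?D (dilation \<sigma> c x) (dilation \<sigma> c v))) (at 0)"
  proof -
    have d0: "dilation \<sigma> c 0 = 0"
      by (simp add: dilation_def vec_eq_iff)
    have "((\<lambda>z. dilation \<sigma> c x \<otimes> z) has_derivative ?D (dilation \<sigma> c x)) (at (dilation \<sigma> c 0))"
      unfolding d0 by (rule left_mult_has_derivative)
    from has_derivative_compose[OF bounded_linear_imp_has_derivative[OF bounded_linear_dilation] this]
    show ?thesis .
  qed
  ultimately have "(\<lambda>v. dilation \<sigma> c (?D x v)) = (\<lambda>v. ?D (dilation \<sigma> c x) (dilation \<sigma> c v))"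
    unfolding dilation_mult[OF assms] by (rule has_derivative_unique)
  then have "dilation \<sigma> c (?D x (axis k 1)) = ?D (dilation \<sigma> c x) (c ^ \<sigma> k *\<^sub>R axis k 1)"
    by (simp only: fun_eq_iff dilation_axis)
  then show ?thesis
    by (simp add: jacobian_generator_eq
        linear_scale[OF has_derivative_linear[OF left_mult_has_derivative]])
qed

text \<open>
  The generator is a directional derivative of the smooth multiplication
  \<open>F(x, y) = x \<otimes> y\<close>, taken at \<open>(x, 0)\<close>.
\<close>
lemma generator_continuously_differentiable:
  obtains D where "\<And>x. (jacobian_generator G k has_derivative D x) (at x)"
    and "\<And>v. continuous_on UNIV (\<lambda>x. D x v)"
proof -
  define F where "F = (\<lambda>(x, y). x \<otimes> y)"
  define H where "H p = frechet_derivative F (at p) (0, axis k 1)" for p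
  have F: "smooth F" unfolding F_def by (rule smooth_mult)
  have H: "smooth H" unfolding H_def by (rule smooth_frechet_derivative[OF F])
  have gen: "jacobian_generator G k = (\<lambda>x. H (x, 0))"
  proof
    fix x
    have "((\<lambda>z. F (x, z)) has_derivative (\<lambda>v. frechet_derivative F (at (x, 0)) (0, v))) (at 0)"
      by (rule has_derivative_compose[OF _ smooth_has_derivative[OF F]])
         (auto intro!: derivative_eq_intros)
    then have "((\<lambda>z. x \<otimes> z) has_derivative (\<lambda>v. frechet_derivative F (at (x, 0)) (0, v))) (at 0)"
      by (simp add: F_def)
    from frechet_derivative_at[OF this]
    show "jacobian_generator G k x = H (x, 0)"
      by (simp add: jacobian_generator_eq H_def fun_eq_iff)
  qed
  show ?thesis
  proof
    show "(jacobian_generator G k has_derivative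
        (\<lambda>v. frechet_derivative H (at (x, 0)) (v, 0))) (at x)" for x
      unfolding gen
      by (rule has_derivative_compose[OF _ smooth_has_derivative[OF H]])
         (auto intro!: derivative_eq_intros)
    show "continuous_on UNIV (\<lambda>x. frechet_derivative H (at (x, 0)) (v, 0))" for v
      by (rule continuous_on_compose2
          [OF smooth_continuous_on[OF smooth_frechet_derivative[OF H]], of UNIV "\<lambda>x. (x, 0)"])
         (auto intro!: continuous_intros)
  qed
qed

lemma continuous_on_generator: "continuous_on UNIV (jacobian_generator G k)"
  by (rule generator_continuously_differentiable[of k])
     (auto intro!: continuous_at_imp_continuous_on has_derivative_continuous)

text \<open>
  The coefficient \<open>a\<^sub>i\<close> of the generator in direction \<open>i\<close> does not depend on \<open>x\<^sub>i\<close>. Since \<open>a\<^sub>i\<close>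
  has degree \<open>\<sigma> i - 1\<close> and \<open>x\<^sub>i\<close> has degree \<open>\<sigma> i\<close>, the continuous function \<open>\<partial>\<^sub>i a\<^sub>i\<close> is
  homogeneous of degree \<open>-1\<close>, and such a function is zero: \<open>\<partial>\<^sub>i a\<^sub>i (x) = c \<partial>\<^sub>i a\<^sub>i (\<delta>\<^sub>c x)\<close>
  tends to zero with \<open>c\<close>.
\<close>
lemma generator_coefficient_constant:
  assumes k: "k \<in> stratum \<sigma> 1"
  shows "jacobian_generator G k (x + t *\<^sub>R axis i 1) $ i = jacobian_generator G k x $ i"
proof -
  let ?X = "jacobian_generator G k"
  obtain D where D: "\<And>x. (?X has_derivative D x) (at x)"
    and Dc: "\<And>v. continuous_on UNIV (\<lambda>x. D x v)"
    using generator_continuously_differentiable[of k] by blast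
  have D0: "D x (axis i 1) $ i = 0" for x
  proof -
    have scale: "c * (D (dilation \<sigma> c x) (axis i 1) $ i) = D x (axis i 1) $ i" if c: "c > 0" for c
    proof -
      have "((\<lambda>x. c *\<^sub>R ?X (dilation \<sigma> c x)) has_derivative
          (\<lambda>v. c *\<^sub>R D (dilation \<sigma> c x) (dilation \<sigma> c v))) (at x)"
        by (intro has_derivative_scaleR_right has_derivative_compose[OF _ D]
            bounded_linear_imp_has_derivative[OF bounded_linear_dilation])
      moreover have "((\<lambda>x. dilation \<sigma> c (?X x)) has_derivative (\<lambda>v. dilation \<sigma> c (D x v))) (at x)"
        by (rule bounded_linear.has_derivative[OF bounded_linear_dilation D])
      moreover have "c *\<^sub>R ?X (dilation \<sigma> c x) = dilation \<sigma> c (?X x)" for x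
        using generator_dilation[OF c, of k x] k by (simp add: stratum_def)
      ultimately have "(\<lambda>v. c *\<^sub>R D (dilation \<sigma> c x) (dilation \<sigma> c v)) = (\<lambda>v. dilation \<sigma> c (D x v))"
        by (auto intro: has_derivative_unique)
      then have "c *\<^sub>R D (dilation \<sigma> c x) (dilation \<sigma> c (axis i 1)) = dilation \<sigma> c (D x (axis i 1))"
        by (rule fun_cong)
      then have "c *\<^sub>R c ^ \<sigma> i *\<^sub>R D (dilation \<sigma> c x) (axis i 1) = dilation \<sigma> c (D x (axis i 1))"
        by (simp only: dilation_axis linear_scale[OF has_derivative_linear[OF D]])
      from arg_cong[OF this, of "\<lambda>y. y $ i"]
      show ?thesis using c by (simp add: dilation_def)
    qed
    have "((\<lambda>c. D (dilation \<sigma> c x) (axis i 1)) \<longlongrightarrow> D 0 (axis i 1)) (at_right 0)"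
      by (rule continuous_on_tendsto_compose[OF Dc tendsto_dilation_0])
         (auto simp: weight_nonzero)
    then have "((\<lambda>c. c * (D (dilation \<sigma> c x) (axis i 1) $ i)) \<longlongrightarrow> 0 * (D 0 (axis i 1) $ i)) (at_right 0)"
      by (intro tendsto_intros)
    moreover have "eventually (\<lambda>c. c * (D (dilation \<sigma> c x) (axis i 1) $ i) = D x (axis i 1) $ i)
        (at_right 0)"
      using eventually_at_right_less[of "0::real"] by eventually_elim (rule scale)
    ultimately have "((\<lambda>c. D x (axis i 1) $ i) \<longlongrightarrow> 0 * (D 0 (axis i 1) $ i)) (at_right (0::real))"
      by (rule Lim_transform_eventually)
    then show ?thesis
      using tendsto_unique[OF trivial_limit_at_right_real tendsto_const] by force
  qed
  have "((\<lambda>t. ?X (x + t *\<^sub>R axis i 1) $ i) has_real_derivative 0) (at t)" for t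
  proof -
    have "((\<lambda>t. x + t *\<^sub>R axis i 1) has_derivative (\<lambda>s. s *\<^sub>R axis i 1)) (at t)"
      by (auto intro!: derivative_eq_intros)
    from bounded_linear.has_derivative[OF bounded_linear_vec_nth has_derivative_compose[OF this D]]
    show ?thesis
      by (rule has_derivative_imp_has_field_derivative)
         (simp add: linear_scale[OF has_derivative_linear[OF D]] D0)
  qed
  then show ?thesis
    using DERIV_isconst_all[of "\<lambda>t. ?X (x + t *\<^sub>R axis i 1) $ i" t 0] by simp
qed

text \<open>
  The first-stratum generators are formally skew-adjoint. By
  \<open>generator_coefficient_constant\<close> each summand
  \<open>a\<^sub>i \<partial>\<^sub>i \<phi>\<close> of \<open>X \<phi>\<close> is the derivative of \<open>a\<^sub>i \<phi>\<close> in the coordinate direction \<open>i\<close>, and so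
  integrates to zero.
\<close>
lemma integral_generator_eq_0:
  fixes \<phi> :: "real ^ 'd \<Rightarrow> real"
  assumes k: "k \<in> stratum \<sigma> 1"
    and deriv: "\<And>x. (\<phi> has_derivative \<phi>' x) (at x)"
    and cont: "\<And>v. continuous_on UNIV (\<lambda>x. \<phi>' x v)"
    and supp: "\<And>x. \<phi> x \<noteq> 0 \<Longrightarrow> norm x \<le> R"
  shows "integrable lborel (\<lambda>x. \<phi>' x (jacobian_generator G k x))"
    and "(\<integral>x. \<phi>' x (jacobian_generator G k x) \<partial>lborel) = 0"
proof -
  let ?X = "jacobian_generator G k"
  define h where "h i x = ?X x $ i * \<phi> x" for i x
  define h' where "h' i x = ?X x $ i * \<phi>' x (axis i 1)" for i x
  note Xc = continuous_on_generator[of k]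
  have \<phi>c: "continuous_on UNIV \<phi>"
    using deriv by (auto intro!: continuous_at_imp_continuous_on has_derivative_continuous)
  have "((\<lambda>t. h i (x + t *\<^sub>R axis i 1)) has_real_derivative h' i x) (at 0)" for i x
  proof -
    have "((\<lambda>t. \<phi> (x + t *\<^sub>R axis i 1)) has_derivative
        (\<lambda>s. \<phi>' (x + 0 *\<^sub>R axis i 1) (s *\<^sub>R axis i 1))) (at 0)"
      by (rule has_derivative_compose[OF _ deriv]) (auto intro!: derivative_eq_intros)
    then have "((\<lambda>t. \<phi> (x + t *\<^sub>R axis i 1)) has_real_derivative \<phi>' x (axis i 1)) (at 0)"
      by (rule has_derivative_imp_has_field_derivative)
         (simp add: linear_scale[OF has_derivative_linear[OF deriv]])
    then show ?thesis
      unfolding h_def h'_def generator_coefficient_constant[OF k] by (rule DERIV_cmult)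
  qed
  moreover have "continuous_on UNIV (h i)" "continuous_on UNIV (h' i)" for i
    unfolding h_def[abs_def] h'_def[abs_def] using Xc \<phi>c cont by (auto intro!: continuous_intros)
  moreover have "norm x \<le> R" if "h i x \<noteq> 0" for i x
    using that supp by (auto simp: h_def)
  ultimately have h': "integrable lborel (h' i)" "(\<integral>x. h' i x \<partial>lborel) = 0" for i
    using integral_directional_derivative_eq_0[of "h i" "axis i 1" "h' i" R] by blast+
  have "\<phi>' x (?X x) = (\<Sum>i\<in>UNIV. h' i x)" for x
    using linear_eq_sum_axis[OF has_derivative_linear[OF deriv], of x "?X x"]
    by (simp add: h'_def)
  then show "integrable lborel (\<lambda>x. \<phi>' x (?X x))" "(\<integral>x. \<phi>' x (?X x) \<partial>lborel) = 0"
    using h' by simp_all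
qed

end

section \<open>Regularised multipolar potentials\<close>

text \<open>
  The set \<open>S\<close> of coordinates stands for the first stratum.
  For \<open>\<epsilon> = 0\<close> this is the Euclidean distance of the projections of \<open>x\<close> and \<open>p\<close> to
  \<open>\<real>\<^sup>S\<close>; a positive \<open>\<epsilon>\<close> removes its zeros and makes all functions below smooth.
\<close>
definition reg_dist :: "'d set \<Rightarrow> real \<Rightarrow> real ^ 'd \<Rightarrow> real ^ 'd \<Rightarrow> real"
  where "reg_dist S \<epsilon> p x = sqrt (\<epsilon> + (\<Sum>j\<in>S. (x $ j - p $ j)\<^sup>2))"

definition potential :: "'d set \<Rightarrow> real \<Rightarrow> 'k set \<Rightarrow> ('k \<Rightarrow> real ^ 'd) \<Rightarrow> real ^ 'd \<Rightarrow> real"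
  where "potential S \<epsilon> K p x = (\<Sum>k\<in>K. 1 / reg_dist S \<epsilon> (p k) x ^ (card S - 2))"

text \<open>
  The gradient of the potential is \<open>- (n - 2)\<close> times this vector, where \<open>n\<close> is the cardinality of
  \<open>S\<close>; leaving the factor out keeps the expression that occurs in the Hardy weight.
\<close>
definition force :: "'d set \<Rightarrow> real \<Rightarrow> 'k set \<Rightarrow> ('k \<Rightarrow> real ^ 'd) \<Rightarrow> 'd \<Rightarrow> real ^ 'd \<Rightarrow> real"
  where "force S \<epsilon> K p j x = (\<Sum>k\<in>K. (x $ j - p k $ j) / reg_dist S \<epsilon> (p k) x ^ card S)"

definition log_force :: "'d set \<Rightarrow> real \<Rightarrow> 'k set \<Rightarrow> ('k \<Rightarrow> real ^ 'd) \<Rightarrow> 'd \<Rightarrow> real ^ 'd \<Rightarrow> real"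
  where "log_force S \<epsilon> K p j x = force S \<epsilon> K p j x / potential S \<epsilon> K p x"

definition force_derivative ::
    "'d set \<Rightarrow> real \<Rightarrow> 'k set \<Rightarrow> ('k \<Rightarrow> real ^ 'd) \<Rightarrow> 'd \<Rightarrow> real ^ 'd \<Rightarrow> real ^ 'd \<Rightarrow> real"
  where "force_derivative S \<epsilon> K p j x v = (\<Sum>k\<in>K. v $ j / reg_dist S \<epsilon> (p k) x ^ card S
      - real (card S) * (x $ j - p k $ j) * (\<Sum>i\<in>S. (x $ i - p k $ i) * v $ i)
          / reg_dist S \<epsilon> (p k) x ^ (card S + 2))"

text \<open>
  The quotient rule for \<^const>\<open>log_force\<close>, with the derivative of the denominator expressed through
  \<^const>\<open>log_force\<close> itself; see \<open>log_force_has_derivative\<close> below.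
\<close>
definition log_force_derivative ::
    "'d set \<Rightarrow> real \<Rightarrow> 'k set \<Rightarrow> ('k \<Rightarrow> real ^ 'd) \<Rightarrow> 'd \<Rightarrow> real ^ 'd \<Rightarrow> real ^ 'd \<Rightarrow> real"
  where "log_force_derivative S \<epsilon> K p j x v = force_derivative S \<epsilon> K p j x v / potential S \<epsilon> K p x
      + (real (card S) - 2) * log_force S \<epsilon> K p j x * (\<Sum>i\<in>S. log_force S \<epsilon> K p i x * v $ i)"

lemma reg_dist_pos: "\<epsilon> > 0 \<Longrightarrow> reg_dist S \<epsilon> p x > 0"
  unfolding reg_dist_def by (simp add: add_pos_nonneg sum_nonneg)

lemma reg_dist_nz: "\<epsilon> > 0 \<Longrightarrow> reg_dist S \<epsilon> p x \<noteq> 0"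
  using reg_dist_pos[of \<epsilon> S p x] by simp

lemma reg_dist_square: "\<epsilon> \<ge> 0 \<Longrightarrow> (reg_dist S \<epsilon> p x)\<^sup>2 = \<epsilon> + (\<Sum>j\<in>S. (x $ j - p $ j)\<^sup>2)"
  unfolding reg_dist_def by (simp add: sum_nonneg)

lemma potential_pos:
  assumes "\<epsilon> > 0" "finite K" "K \<noteq> {}"
  shows "potential S \<epsilon> K p x > 0"
  unfolding potential_def using assms by (intro sum_pos) (auto simp: reg_dist_pos)

lemma potential_nz:
  assumes "\<epsilon> > 0" "finite K" "K \<noteq> {}"
  shows "potential S \<epsilon> K p x \<noteq> 0"
  using potential_pos[OF assms, of S p x] by simp

lemma continuous_on_reg_dist [continuous_intros]: "continuous_on A (reg_dist S \<epsilon> p)"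
  unfolding reg_dist_def[abs_def] by (intro continuous_intros)

lemma continuous_on_potential: "\<epsilon> > 0 \<Longrightarrow> continuous_on A (potential S \<epsilon> K p)"
  unfolding potential_def[abs_def] by (intro continuous_intros) (auto simp: reg_dist_nz)

lemma continuous_on_force: "\<epsilon> > 0 \<Longrightarrow> continuous_on A (force S \<epsilon> K p j)"
  unfolding force_def[abs_def] by (intro continuous_intros) (auto simp: reg_dist_nz)

lemma continuous_on_log_force:
  assumes "\<epsilon> > 0" "finite K" "K \<noteq> {}"
  shows "continuous_on A (log_force S \<epsilon> K p j)"
  unfolding log_force_def[abs_def]
  by (intro continuous_intros continuous_on_force continuous_on_potential assms)
    (simp add: potential_nz[OF assms])

lemma continuous_on_log_force_derivative:
  assumes "\<epsilon> > 0" "finite K" "K \<noteq> {}"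
  shows "continuous_on A (\<lambda>x. log_force_derivative S \<epsilon> K p j x v)"
  unfolding log_force_derivative_def force_derivative_def
  by (intro continuous_intros continuous_on_log_force continuous_on_potential assms)
    (simp_all add: potential_nz[OF assms] reg_dist_nz[OF assms(1)])

lemma inverse_reg_dist_has_derivative:
  assumes "\<epsilon> > 0"
  shows "((\<lambda>x. 1 / reg_dist S \<epsilon> p x ^ n) has_derivative
    (\<lambda>v. - (real n * (\<Sum>i\<in>S. (x $ i - p $ i) * v $ i) / reg_dist S \<epsilon> p x ^ (n + 2)))) (at x)"
proof -
  let ?q = "\<lambda>x. \<epsilon> + (\<Sum>j\<in>S. (x $ j - p $ j)\<^sup>2)"
  have q: "?q x > 0"
    using assms by (simp add: add_pos_nonneg sum_nonneg)
  have "(?q has_derivative (\<lambda>v. \<Sum>i\<in>S. 2 * ((x $ i - p $ i) * v $ i))) (at x)"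
    by (auto intro!: derivative_eq_intros bounded_linear.has_derivative[OF bounded_linear_vec_nth]
        sum.cong simp: algebra_simps)
  moreover have "((\<lambda>y. 1 / sqrt y ^ n) has_real_derivative - (real n / 2 / sqrt (?q x) ^ (n + 2)))
      (at (?q x))"
    using q by (cases n) (auto intro!: derivative_eq_intros
        simp: divide_simps power2_eq_square simp flip: power_Suc power_add)
  ultimately have "((\<lambda>x. 1 / sqrt (?q x) ^ n) has_derivative
     (\<lambda>v. (- (real n / 2 / sqrt (?q x) ^ (n + 2))) * (\<Sum>i\<in>S. 2 * ((x $ i - p $ i) * v $ i)))) (at x)"
    unfolding has_field_derivative_def by (rule has_derivative_compose)
  then show ?thesis
    unfolding reg_dist_def sum_distrib_left[symmetric] by (simp add: mult.assoc)
qed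

lemma potential_has_derivative:
  assumes "\<epsilon> > 0" "card S \<ge> 2"
  shows "(potential S \<epsilon> K p has_derivative
    (\<lambda>v. - ((real (card S) - 2) * (\<Sum>i\<in>S. force S \<epsilon> K p i x * v $ i)))) (at x)"
proof -
  have exponent: "card S - 2 + 2 = card S" and coefficient: "real (card S - 2) = real (card S) - 2"
    using assms by simp_all
  have "(potential S \<epsilon> K p has_derivative (\<lambda>v. \<Sum>k\<in>K. - (real (card S - 2) *
      (\<Sum>i\<in>S. (x $ i - p k $ i) * v $ i) / reg_dist S \<epsilon> (p k) x ^ (card S - 2 + 2)))) (at x)"
    unfolding potential_def[abs_def]
    by (intro has_derivative_sum inverse_reg_dist_has_derivative assms)
  moreover have "(\<Sum>k\<in>K. - ((real (card S) - 2) *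
      (\<Sum>i\<in>S. (x $ i - p k $ i) * v $ i) / reg_dist S \<epsilon> (p k) x ^ card S)) =
      - ((real (card S) - 2) * (\<Sum>i\<in>S. force S \<epsilon> K p i x * v $ i))" for v
    unfolding force_def sum_distrib_right sum.swap[of _ K S]
    by (simp add: sum_negf sum_distrib_left sum_divide_distrib sum.swap[of _ K S])
  ultimately show ?thesis
    unfolding exponent coefficient by simp
qed

lemma force_has_derivative:
  assumes "\<epsilon> > 0"
  shows "(force S \<epsilon> K p j has_derivative force_derivative S \<epsilon> K p j x) (at x)"
proof -
  have "((\<lambda>x. (x $ j - p k $ j) * (1 / reg_dist S \<epsilon> (p k) x ^ card S)) has_derivative
      (\<lambda>v. v $ j / reg_dist S \<epsilon> (p k) x ^ card S
      - real (card S) * (x $ j - p k $ j) * (\<Sum>i\<in>S. (x $ i - p k $ i) * v $ i)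
          / reg_dist S \<epsilon> (p k) x ^ (card S + 2))) (at x)" for k
    by (rule has_derivative_eq_rhs, rule has_derivative_mult,
        rule has_derivative_diff[OF bounded_linear_imp_has_derivative[OF bounded_linear_vec_nth] has_derivative_const],
        rule inverse_reg_dist_has_derivative[OF assms]) (simp add: fun_eq_iff)
  then have "((\<lambda>x. \<Sum>k\<in>K. (x $ j - p k $ j) * (1 / reg_dist S \<epsilon> (p k) x ^ card S)) has_derivative
      force_derivative S \<epsilon> K p j x) (at x)"
    unfolding force_derivative_def[abs_def] by (intro has_derivative_sum)
  then show ?thesis
    by (simp add: force_def[abs_def])
qed

lemma log_force_has_derivative:
  assumes "\<epsilon> > 0" "finite K" "K \<noteq> {}" "card S \<ge> 2"
  shows "(log_force S \<epsilon> K p j has_derivative log_force_derivative S \<epsilon> K p j x) (at x)"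
proof -
  have w: "potential S \<epsilon> K p x \<noteq> 0"
    by (rule potential_nz[OF assms(1-3)])
  show ?thesis
    unfolding log_force_def[abs_def]
    by (rule has_derivative_eq_rhs,
        rule has_derivative_divide'
          [OF force_has_derivative[OF assms(1)] potential_has_derivative[OF assms(1,4)] w])
      (use w in \<open>simp add: fun_eq_iff log_force_derivative_def log_force_def divide_simps
        flip: sum_divide_distrib\<close>)
qed

text \<open>
  This is where the exponent \<open>n - 2\<close> enters, with \<open>n\<close> the cardinality of \<open>S\<close>. Write \<open>\<rho>\<close> for the
  regularised distance. The divergence of \<open>(x - p) / \<rho>\<^sup>n\<close> is
  \<open>n / \<rho>\<^sup>n - n (\<rho>\<^sup>2 - \<epsilon>) / \<rho>\<^bsup>n + 2\<^esup> = n \<epsilon> / \<rho>\<^bsup>n + 2\<^esup>\<close>,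
  which is nonnegative: the regularised potential is superharmonic, as a sum of superharmonic
  functions, however many poles there are. What remains of the divergence of the quotient is the
  square that the derivative of the denominator contributes.

  The vectors \<open>V j\<close> stand for the values at \<open>x\<close> of the first-stratum generators.
\<close>
lemma divergence_log_force_ge:
  assumes "\<epsilon> > 0" "finite K" "K \<noteq> {}"
    and V: "\<And>i j. i \<in> S \<Longrightarrow> j \<in> S \<Longrightarrow> V j $ i = (if i = j then 1 else 0)"
  shows "(\<Sum>j\<in>S. log_force_derivative S \<epsilon> K p j x (V j)) \<ge>
    (real (card S) - 2) * (\<Sum>j\<in>S. (log_force S \<epsilon> K p j x)\<^sup>2)"
proof (cases "finite S")
  case fin: True
  have pick: "(\<Sum>i\<in>S. f i * V j $ i) = f j" if "j \<in> S" for f :: "_ \<Rightarrow> real" and j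
  proof -
    have "(\<Sum>i\<in>S. f i * V j $ i) = (\<Sum>i\<in>S. if i = j then f i else 0)"
      by (intro sum.cong) (auto simp: V that)
    then show ?thesis using fin that by simp
  qed
  have diag: "V j $ j = 1" if "j \<in> S" for j
    using V that by simp
  let ?r = "\<lambda>k. reg_dist S \<epsilon> (p k) x"
  have "(\<Sum>j\<in>S. force_derivative S \<epsilon> K p j x (V j)) =
      (\<Sum>j\<in>S. \<Sum>k\<in>K. 1 / ?r k ^ card S - real (card S) * (x $ j - p k $ j)\<^sup>2 / ?r k ^ (card S + 2))"
    by (intro sum.cong) (simp_all add: force_derivative_def pick diag power2_eq_square mult.assoc)
  also have "\<dots> = (\<Sum>k\<in>K. real (card S) * \<epsilon> / ?r k ^ (card S + 2))"
  proof (subst sum.swap, intro sum.cong refl)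
    fix k
    have "(\<Sum>j\<in>S. 1 / ?r k ^ card S - real (card S) * (x $ j - p k $ j)\<^sup>2 / ?r k ^ (card S + 2)) =
        real (card S) / ?r k ^ card S - real (card S) * ((?r k)\<^sup>2 - \<epsilon>) / ?r k ^ (card S + 2)"
      using assms(1) by (simp add: reg_dist_square sum_subtractf sum_distrib_left sum_divide_distrib)
    also have "\<dots> = real (card S) * \<epsilon> / ?r k ^ (card S + 2)"
      using reg_dist_nz[OF assms(1), of S "p k" x]
      by (simp add: field_simps power_add power2_eq_square)
    finally show "(\<Sum>j\<in>S. 1 / ?r k ^ card S - real (card S) * (x $ j - p k $ j)\<^sup>2 / ?r k ^ (card S + 2)) =
        real (card S) * \<epsilon> / ?r k ^ (card S + 2)" .
  qed
  also have "\<dots> \<ge> 0"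
    using assms(1) by (intro sum_nonneg) (simp add: reg_dist_pos less_imp_le)
  finally have "0 \<le> (\<Sum>j\<in>S. force_derivative S \<epsilon> K p j x (V j)) / potential S \<epsilon> K p x"
    using potential_pos[OF assms(1-3), of S p x] by simp
  moreover have "(\<Sum>j\<in>S. log_force_derivative S \<epsilon> K p j x (V j)) =
      (\<Sum>j\<in>S. force_derivative S \<epsilon> K p j x (V j)) / potential S \<epsilon> K p x +
      (real (card S) - 2) * (\<Sum>j\<in>S. (log_force S \<epsilon> K p j x)\<^sup>2)"
    unfolding log_force_derivative_def
    by (simp add: pick sum.distrib sum_divide_distrib sum_distrib_left power2_eq_square mult.assoc)
  ultimately show ?thesis by simp
qed simp

section \<open>The Hardy inequality with a regularised weight\<close>

text \<open>
  This is \<open>\<bar>z + t w\<bar>\<^sup>2 \<ge> 0\<close>. The real inner product is the real part of a Hermitian product, so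
  that \<open>2 (w \<bullet> z)\<close> is the derivative of \<open>\<bar>w\<bar>\<^sup>2\<close> if \<open>z\<close> is that of \<open>w\<close>.
\<close>
lemma norm_complement_square:
  fixes z w :: complex
  shows "(cmod z)\<^sup>2 \<ge> - (2 * t * (w \<bullet> z)) - t\<^sup>2 * (cmod w)\<^sup>2"
proof -
  have "0 \<le> (cmod (z + t *\<^sub>R w))\<^sup>2" by simp
  also have "\<dots> = (cmod z)\<^sup>2 + 2 * t * (w \<bullet> z) + t\<^sup>2 * (cmod w)\<^sup>2"
    unfolding power2_norm_eq_inner
    by (simp add: inner_add_left inner_add_right inner_commute[of z w] power2_eq_square algebra_simps)
  finally show ?thesis by linarith
qed

lemma (in stratified_group) norm_horizontal_gradient:
  "(norm (horizontal_gradient G \<sigma> u x))\<^sup>2 =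
    (\<Sum>j\<in>stratum \<sigma> 1. (cmod (apply_field (jacobian_generator G j) u x))\<^sup>2)"
proof -
  have "(norm (horizontal_gradient G \<sigma> u x))\<^sup>2 =
    (\<Sum>j\<in>UNIV. if j \<in> stratum \<sigma> 1 then (cmod (apply_field (jacobian_generator G j) u x))\<^sup>2 else 0)"
    unfolding norm_vec_def L2_set_def
    by (simp add: sum_nonneg) (auto intro!: sum.cong simp: horizontal_gradient_def first_layer_def)
  then show ?thesis by (simp add: sum.If_cases)
qed

text \<open>
  Let \<open>\<beta>\<^sub>j\<close> be the components of \<^const>\<open>log_force\<close> and \<open>c = (n - 2) / 2\<close>. Expanding
  \<open>\<bar>X\<^sub>j u + c \<beta>\<^sub>j u\<bar>\<^sup>2 \<ge> 0\<close> leaves the cross term \<open>c \<beta>\<^sub>j X\<^sub>j \<bar>u\<bar>\<^sup>2\<close>, which is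
  \<open>c X\<^sub>j (\<beta>\<^sub>j \<bar>u\<bar>\<^sup>2)\<close>, of integral zero, minus \<open>c (X\<^sub>j \<beta>\<^sub>j) \<bar>u\<bar>\<^sup>2\<close>. After summation over \<open>j\<close>
  the divergence bound gives \<open>2 c\<^sup>2 \<Sum>\<^sub>j \<beta>\<^sub>j\<^sup>2 \<bar>u\<bar>\<^sup>2\<close>, of which the square consumes one half.
\<close>
lemma (in stratified_group) regularised_hardy_inequality:
  fixes u :: "real ^ 'd \<Rightarrow> complex"
  assumes u: "u \<in> test_functions \<Omega>" and N: "card (stratum \<sigma> 1) \<ge> 2"
    and \<epsilon>: "\<epsilon> > 0" and K: "finite K" "K \<noteq> {}"
  shows "(\<integral>\<^sup>+ x. ennreal (((real (card (stratum \<sigma> 1)) - 2) / 2)\<^sup>2 *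
        (\<Sum>j\<in>stratum \<sigma> 1. (log_force (stratum \<sigma> 1) \<epsilon> K p j x)\<^sup>2) * (cmod (u x))\<^sup>2) \<partial>lborel)
    \<le> (\<integral>\<^sup>+ x. ennreal ((norm (horizontal_gradient G \<sigma> u x))\<^sup>2) \<partial>lborel)"
proof -
  let ?S = "stratum \<sigma> 1"
  let ?X = "jacobian_generator G"
  let ?u' = "\<lambda>x. frechet_derivative u (at x)"
  let ?\<beta> = "log_force ?S \<epsilon> K p" and ?\<beta>' = "log_force_derivative ?S \<epsilon> K p"
  define c where "c = (real (card ?S) - 2) / 2"
  have c: "c \<ge> 0" and two_c: "2 * c = real (card ?S) - 2" using N by (simp_all add: c_def)
  define A where "A x = (norm (horizontal_gradient G \<sigma> u x))\<^sup>2" for x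
  define B where "B x = c\<^sup>2 * (\<Sum>j\<in>?S. (?\<beta> j x)\<^sup>2) * (cmod (u x))\<^sup>2" for x
  \<comment> \<open>The derivative of \<open>\<beta>\<^sub>j \<bar>u\<bar>\<^sup>2\<close>.\<close>
  define \<phi>' where "\<phi>' j x v = ?\<beta> j x * (2 * (u x \<bullet> ?u' x v)) + ?\<beta>' j x v * (cmod (u x))\<^sup>2" for j x v
  have sm: "smooth u" and comp: "compact (closure {x. u x \<noteq> 0})"
    using u by (auto simp: test_functions_def)
  have u': "(u has_derivative ?u' x) (at x)" for x
    by (rule smooth_has_derivative[OF sm])
  have uc: "continuous_on UNIV u"
    by (rule smooth_continuous_on[OF sm])
  have u'c: "continuous_on UNIV (\<lambda>x. ?u' x v)" for v
    by (intro smooth_continuous_on smooth_frechet_derivative sm)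
  have Xuc: "continuous_on UNIV (\<lambda>x. ?u' x (?X j x))" for j
    unfolding linear_eq_sum_axis[OF has_derivative_linear[OF u'], of _ "?X j _"]
    by (intro continuous_intros continuous_on_generator u'c)
  obtain R where R: "\<And>x. x \<in> closure {x. u x \<noteq> 0} \<Longrightarrow> norm x \<le> R"
    using compact_imp_bounded[OF comp] unfolding bounded_iff by blast
  have supp: "norm x \<le> R" if "u x \<noteq> 0" for x
    using that R closure_subset[of "{x. u x \<noteq> 0}"] by blast
  have \<phi>_deriv: "((\<lambda>x. ?\<beta> j x * (cmod (u x))\<^sup>2) has_derivative \<phi>' j x) (at x)" for j x
  proof -
    have "((\<lambda>x. u x \<bullet> u x) has_derivative (\<lambda>v. u x \<bullet> ?u' x v + ?u' x v \<bullet> u x)) (at x)"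
      by (rule has_derivative_inner[OF u' u'])
    then have "((\<lambda>x. (cmod (u x))\<^sup>2) has_derivative (\<lambda>v. 2 * (u x \<bullet> ?u' x v))) (at x)"
      by (simp add: power2_norm_eq_inner inner_commute)
    from has_derivative_mult[OF log_force_has_derivative[OF \<epsilon> K N] this]
    show ?thesis unfolding \<phi>'_def[abs_def] .
  qed
  have \<phi>_cont: "continuous_on UNIV (\<lambda>x. \<phi>' j x v)" for j v
    unfolding \<phi>'_def
    by (intro continuous_intros continuous_on_log_force continuous_on_log_force_derivative \<epsilon> K uc u'c)
  have E: "integrable lborel (\<lambda>x. \<phi>' j x (?X j x))" "(\<integral>x. \<phi>' j x (?X j x) \<partial>lborel) = 0"
    if "j \<in> ?S" for j
    using integral_generator_eq_0[OF that \<phi>_deriv \<phi>_cont, where R = R] supp by auto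
  have A_eq: "A x = (\<Sum>j\<in>?S. (cmod (?u' x (?X j x)))\<^sup>2)" for x
    unfolding A_def norm_horizontal_gradient apply_field_def ..
  have A_int: "integrable lborel A"
  proof (rule integrable_continuous_bounded_support)
    show "continuous_on UNIV A"
      unfolding A_eq[abs_def] by (intro continuous_intros Xuc)
    show "A x = 0" if "norm x > R" for x
    proof -
      have "x \<notin> closure {x. u x \<noteq> 0}" using R[of x] that by auto
      then show ?thesis unfolding A_eq by (simp add: frechet_derivative_outside_support)
    qed
  qed
  have B_int: "integrable lborel B"
  proof (rule integrable_continuous_bounded_support)
    show "continuous_on UNIV B"
      unfolding B_def[abs_def] by (intro continuous_intros continuous_on_log_force \<epsilon> K uc)
    show "B x = 0" if "norm x > R" for x
      using supp[of x] that by (force simp: B_def)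
  qed
  \<comment> \<open>The inequality holds before integration, up to a divergence.\<close>
  have pointwise: "B x \<le> A x + c * (\<Sum>j\<in>?S. \<phi>' j x (?X j x))" for x
  proof -
    let ?U = "(cmod (u x))\<^sup>2" and ?P = "\<lambda>j. u x \<bullet> ?u' x (?X j x)"
    have "2 * c * (\<Sum>j\<in>?S. (?\<beta> j x)\<^sup>2) \<le> (\<Sum>j\<in>?S. ?\<beta>' j x (?X j x))"
      using divergence_log_force_ge[OF \<epsilon> K, of ?S "\<lambda>j. ?X j x" p x]
      unfolding two_c by (simp add: generator_stratum_1 axis_def)
    then have "c * (2 * c * (\<Sum>j\<in>?S. (?\<beta> j x)\<^sup>2) * ?U) \<le> c * ((\<Sum>j\<in>?S. ?\<beta>' j x (?X j x)) * ?U)"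
      using c by (intro mult_left_mono mult_right_mono) auto
    moreover have "- (2 * c * (\<Sum>j\<in>?S. ?\<beta> j x * ?P j)) - c\<^sup>2 * (\<Sum>j\<in>?S. (?\<beta> j x)\<^sup>2) * ?U \<le> A x"
    proof -
      have "(\<Sum>j\<in>?S. - (2 * (c * ?\<beta> j x) * ?P j) - (c * ?\<beta> j x)\<^sup>2 * ?U) \<le> A x"
        unfolding A_eq by (intro sum_mono norm_complement_square)
      then show ?thesis
        by (simp add: sum_subtractf sum_negf sum_distrib_left sum_distrib_right power_mult_distrib mult.assoc)
    qed
    moreover have "c * (\<Sum>j\<in>?S. \<phi>' j x (?X j x)) =
        2 * c * (\<Sum>j\<in>?S. ?\<beta> j x * ?P j) + c * ((\<Sum>j\<in>?S. ?\<beta>' j x (?X j x)) * ?U)"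
      by (simp add: \<phi>'_def sum.distrib sum_distrib_left sum_distrib_right algebra_simps)
    moreover have "c * (2 * c * (\<Sum>j\<in>?S. (?\<beta> j x)\<^sup>2) * ?U) = 2 * B x"
      by (simp add: B_def power2_eq_square)
    moreover have "c\<^sup>2 * (\<Sum>j\<in>?S. (?\<beta> j x)\<^sup>2) * ?U = B x"
      by (simp add: B_def)
    ultimately show ?thesis by linarith
  qed
  have "(\<integral>x. B x \<partial>lborel) \<le> (\<integral>x. A x + c * (\<Sum>j\<in>?S. \<phi>' j x (?X j x)) \<partial>lborel)"
    using A_int B_int E(1) pointwise by (intro integral_mono) auto
  also have "\<dots> = (\<integral>x. A x \<partial>lborel)"
    using A_int E by simp
  finally have "ennreal (\<integral>x. B x \<partial>lborel) \<le> ennreal (\<integral>x. A x \<partial>lborel)"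
    by (rule ennreal_leI)
  moreover have "0 \<le> B x" "0 \<le> A x" for x
    unfolding B_def A_def by (auto intro!: mult_nonneg_nonneg sum_nonneg)
  ultimately have "(\<integral>\<^sup>+ x. ennreal (B x) \<partial>lborel) \<le> (\<integral>\<^sup>+ x. ennreal (A x) \<partial>lborel)"
    using A_int B_int by (simp add: nn_integral_eq_integral)
  then show ?thesis
    unfolding A_def B_def c_def .
qed

section \<open>Removing the regularisation\<close>

lemma AE_lborel_coordinate_neq:
  fixes c :: real
  shows "AE x in lborel. (x :: real ^ 'd) $ i \<noteq> c"
proof -
  have "negligible {x :: real ^ 'd. x \<bullet> axis i 1 = c}"
    by (rule negligible_standard_hyperplane) (simp add: axis_in_Basis_iff)
  moreover have "closed {x :: real ^ 'd. x \<bullet> axis i 1 = c}"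
    by (rule closed_hyperplane[of "axis i 1" c, unfolded inner_commute[of "axis i 1"]])
  ultimately have "{x :: real ^ 'd. x \<bullet> axis i 1 = c} \<in> null_sets lborel"
    using null_sets_completion_iff[of "{x :: real ^ 'd. x \<bullet> axis i 1 = c}" lborel]
    by (simp add: negligible_iff_null_sets)
  then have "AE x in lborel. x \<notin> {x :: real ^ 'd. x \<bullet> axis i 1 = c}"
    by (rule AE_not_in)
  then show ?thesis by (simp add: inner_axis)
qed

lemma tendsto_log_force:
  assumes nz: "\<And>k. k \<in> K \<Longrightarrow> reg_dist S 0 (p k) x \<noteq> 0" and K: "finite K" "K \<noteq> {}"
    and s: "(s \<longlongrightarrow> 0) F"
  shows "((\<lambda>n. log_force S (s n) K p j x) \<longlongrightarrow> log_force S 0 K p j x) F"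
proof -
  have r: "((\<lambda>n. reg_dist S (s n) (p k) x) \<longlongrightarrow> reg_dist S 0 (p k) x) F" for k
    unfolding reg_dist_def by (intro tendsto_intros s)
  have "reg_dist S 0 (p k) x > 0" if "k \<in> K" for k
    using nz[OF that] by (simp add: reg_dist_def sum_nonneg less_le)
  then have "potential S 0 K p x > 0"
    unfolding potential_def using K by (intro sum_pos) auto
  then show ?thesis
    unfolding log_force_def force_def potential_def
    by (intro tendsto_intros r) (auto simp: nz)
qed

lemma borel_measurable_log_force: "log_force S \<epsilon> K p j \<in> borel_measurable borel"
proof -
  have [measurable]: "reg_dist S \<epsilon> (p k) \<in> borel_measurable borel" for k
    by (intro borel_measurable_continuous_onI continuous_on_reg_dist)
  have [measurable]: "(\<lambda>x. x $ j) \<in> borel_measurable borel" for j :: 'a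
    by (intro borel_measurable_continuous_onI continuous_intros)
  show ?thesis
    unfolding log_force_def[abs_def] force_def[abs_def] potential_def[abs_def] by measurable
qed

theorem theorem4p1:
  fixes G :: "(real ^ 'd) monoid" and \<sigma> :: "'d \<Rightarrow> nat" and r N m :: nat
    and \<Omega> :: "(real ^ 'd) set" and a :: "nat \<Rightarrow> real ^ 'd" and u :: "real ^ 'd \<Rightarrow> complex"
  assumes "stratified_group G \<sigma> r"
    and "N = card (stratum \<sigma> 1)"
    and "N \<ge> 3"
    and "open \<Omega>"
    and "m \<ge> 1"
    and "u \<in> test_functions \<Omega>"
  shows "(\<integral>\<^sup>+ x\<in>\<Omega>. ennreal ((norm (horizontal_gradient G \<sigma> u x))\<^sup>2) \<partial>lborel)
    \<ge> ennreal (((real N - 2) / 2)\<^sup>2) *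
      (\<integral>\<^sup>+ x\<in>\<Omega>. ennreal
        ((\<Sum>j\<in>stratum \<sigma> 1.
            \<bar>\<Sum>k=1..m. first_layer \<sigma> (x \<otimes>\<^bsub>G\<^esub> inv\<^bsub>G\<^esub> (a k)) $ j
                / norm (first_layer \<sigma> (x \<otimes>\<^bsub>G\<^esub> inv\<^bsub>G\<^esub> (a k))) ^ N\<bar>\<^sup>2)
          / (\<Sum>k=1..m. 1 / norm (first_layer \<sigma> (x \<otimes>\<^bsub>G\<^esub> inv\<^bsub>G\<^esub> (a k))) ^ (N - 2))\<^sup>2
          * (cmod (u x))\<^sup>2) \<partial>lborel)"
proof -
  interpret stratified_group G \<sigma> r by (rule assms(1))
  let ?S = "stratum \<sigma> 1"
  let ?K = "{1..m}"
  define C where "C = ((real N - 2) / 2)\<^sup>2"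
  define f where "f \<epsilon> x = (\<Sum>j\<in>?S. (log_force ?S \<epsilon> ?K a j x)\<^sup>2) * (cmod (u x))\<^sup>2" for \<epsilon> x
  define s where "s n = inverse (real (Suc n))" for n
  have s: "s n > 0" "s \<longlonglongrightarrow> 0" for n
    unfolding s_def[abs_def] by (simp, rule LIMSEQ_inverse_real_of_nat)
  have uc: "continuous_on UNIV u"
    using assms(6) by (auto simp: test_functions_def intro: smooth_continuous_on)
  have f_meas: "f \<epsilon> \<in> borel_measurable borel" for \<epsilon>
  proof -
    have [measurable]: "u \<in> borel_measurable borel"
      using uc by (rule borel_measurable_continuous_onI)
    note [measurable] = borel_measurable_log_force
    show ?thesis unfolding f_def[abs_def] by measurable
  qed
  have coordinate: "first_layer \<sigma> (x \<otimes>\<^bsub>G\<^esub> inv\<^bsub>G\<^esub> (a k)) $ j = x $ j - a k $ j" if "j \<in> ?S" for x k j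
    using that by (simp add: first_layer_def mult_stratum_1 inv_stratum_1)
  have distance: "norm (first_layer \<sigma> (x \<otimes>\<^bsub>G\<^esub> inv\<^bsub>G\<^esub> (a k))) = reg_dist ?S 0 (a k) x" for x k
  proof -
    have "(\<Sum>i\<in>UNIV. (first_layer \<sigma> (x \<otimes>\<^bsub>G\<^esub> inv\<^bsub>G\<^esub> (a k)) $ i)\<^sup>2) =
        (\<Sum>i\<in>?S. (first_layer \<sigma> (x \<otimes>\<^bsub>G\<^esub> inv\<^bsub>G\<^esub> (a k)) $ i)\<^sup>2)"
      by (rule sum.mono_neutral_right) (auto simp: first_layer_def)
    then show ?thesis
      by (simp add: norm_vec_def L2_set_def reg_dist_def coordinate)
  qed
  \<comment> \<open>The weight is the case \<open>\<epsilon> = 0\<close> of the regularised one at every point, including the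
    poles, where both sides follow the convention \<open>y / 0 = 0\<close>.\<close>
  have integrand: "(\<Sum>j\<in>?S.
            \<bar>\<Sum>k=1..m. first_layer \<sigma> (x \<otimes>\<^bsub>G\<^esub> inv\<^bsub>G\<^esub> (a k)) $ j
                / norm (first_layer \<sigma> (x \<otimes>\<^bsub>G\<^esub> inv\<^bsub>G\<^esub> (a k))) ^ N\<bar>\<^sup>2)
          / (\<Sum>k=1..m. 1 / norm (first_layer \<sigma> (x \<otimes>\<^bsub>G\<^esub> inv\<^bsub>G\<^esub> (a k))) ^ (N - 2))\<^sup>2
          * (cmod (u x))\<^sup>2 = f 0 x" for x
    unfolding f_def log_force_def force_def potential_def distance assms(2)
      power_divide sum_divide_distrib[symmetric]
    by (simp add: coordinate)
  \<comment> \<open>Where \<open>x' = a\<^sub>k'\<close> the convergence may fail, but one coordinate of the first stratum already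
    confines those points to finitely many hyperplanes.\<close>
  have f_lim: "AE x in lborel. (\<lambda>n. f (s n) x) \<longlonglongrightarrow> f 0 x"
  proof -
    obtain i where i: "i \<in> ?S"
      using assms(2,3) by fastforce
    have "AE x in lborel. \<forall>k\<in>?K. (x :: real ^ 'd) $ i \<noteq> a k $ i"
      by (intro AE_finite_allI AE_lborel_coordinate_neq) simp
    then show ?thesis
    proof eventually_elim
      case (elim x)
      have "reg_dist ?S 0 (a k) x \<noteq> 0" if "k \<in> ?K" for k
        using elim i that by (auto simp: reg_dist_def sum_nonneg_eq_0_iff)
      then show ?case
        unfolding f_def using assms(5)
        by (intro tendsto_intros tendsto_log_force s) auto
    qed
  qed
  have bound: "(\<integral>\<^sup>+ x. ennreal (C * f (s n) x) \<partial>lborel) \<le>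
      (\<integral>\<^sup>+ x. ennreal ((norm (horizontal_gradient G \<sigma> u x))\<^sup>2) \<partial>lborel)" for n
    using regularised_hardy_inequality[OF assms(6) _ s(1)[of n], of ?K a] assms(2,3,5)
    by (simp add: C_def f_def mult.assoc)
  have "ennreal C * (\<integral>\<^sup>+ x\<in>\<Omega>. ennreal (f 0 x) \<partial>lborel) \<le> ennreal C * (\<integral>\<^sup>+ x. ennreal (f 0 x) \<partial>lborel)"
    by (intro mult_left_mono nn_integral_mono) (auto simp: indicator_def)
  also have "\<dots> = (\<integral>\<^sup>+ x. ennreal (C * f 0 x) \<partial>lborel)"
    using f_meas by (subst nn_integral_cmult[symmetric]) (auto simp: C_def ennreal_mult')
  \<comment> \<open>Fatou's lemma asks for no majorant of the regularised weights, and so for no estimates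
    near the poles.\<close>
  also have "\<dots> \<le> (\<integral>\<^sup>+ x. liminf (\<lambda>n. ennreal (C * f (s n) x)) \<partial>lborel)"
  proof (rule nn_integral_mono_AE, use f_lim in eventually_elim)
    case (elim x)
    then have "(\<lambda>n. ennreal (C * f (s n) x)) \<longlonglongrightarrow> ennreal (C * f 0 x)"
      by (intro tendsto_intros)
    then show ?case
      by (simp add: lim_imp_Liminf)
  qed
  also have "\<dots> \<le> liminf (\<lambda>n. \<integral>\<^sup>+ x. ennreal (C * f (s n) x) \<partial>lborel)"
    using f_meas by (intro nn_integral_liminf) auto
  also have "\<dots> \<le> (\<integral>\<^sup>+ x. ennreal ((norm (horizontal_gradient G \<sigma> u x))\<^sup>2) \<partial>lborel)"
    using bound by (intro Liminf_le) auto
  also have "\<dots> = (\<integral>\<^sup>+ x\<in>\<Omega>. ennreal ((norm (horizontal_gradient G \<sigma> u x))\<^sup>2) \<partial>lborel)"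
  proof (rule nn_integral_cong)
    fix x
    have "(norm (horizontal_gradient G \<sigma> u x))\<^sup>2 = 0" if "x \<notin> \<Omega>"
    proof -
      have "x \<notin> closure {x. u x \<noteq> 0}"
        using assms(6) that by (auto simp: test_functions_def)
      then show ?thesis
        unfolding norm_horizontal_gradient apply_field_def
        by (simp add: frechet_derivative_outside_support)
    qed
    then show "ennreal ((norm (horizontal_gradient G \<sigma> u x))\<^sup>2) =
        ennreal ((norm (horizontal_gradient G \<sigma> u x))\<^sup>2) * indicator \<Omega> x"
      by (simp add: indicator_def)
  qed
  finally show ?thesis
    unfolding integrand C_def .
qed

end
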